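(* Let $\mathfrak{L}$ be a $2$-dimensional real vector space with basis $\{e,f\}$. (a) Equip $\mathfrak{L}$ with the Leibniz bracket $[e,e]=0$, $[e,f]=0$, $[f,e]=0$, $[f,f]=e$. Then all triangular Leibniz bialgebras $(\mathfrak{L},[,],r,\delta_r)$ on this Leibniz algebra are given by $$r=\lambda\, e\otimes e+\gamma\, e\otimes f+\gamma\, f\otimes e,\qquad \lambda,\gamma\in\mathbb{R},$$ with $\delta_r(e)=0$ and $\delta_r(f)=\gamma\, e\otimes e$. (b) Equip $\mathfrak{L}$ with the Leibniz bracket $[e,e]=0$, $[e,f]=0$, $[f,e]=e$, $[f,f]=e$. Then all triangular Leibniz bialgebras $(\mathfrak{L},[,],r,\delta_r)$ on this Leibniz algebra are given by the following two families: (b1) $r=\lambda\, e\otimes e+\gamma\, e\otimes f+\gamma\, f\otimes e$ with $\lambda,\gamma\in\mathbb{R}$, with $\delta_r(e)=0$ and $\delta_r(f)=(\lambda+\gamma)\,e\otimes e+\gamma\, e\otimes f$; (b2) $r=\lambda\, e\otimes e-\lambda\, e\otimes f-\lambda\, f\otimes e+\lambda\, f\otimes f$ with $\lambda\in\mathbb{R}$, with $\delta_r(e)=\lambda(e\otimes f-f\otimes e)$ and $\delta_r(f)=\lambda(e\otimes f-f\otimes e)$.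
   Context: The base field is $\mathbb{R}$. Summation is understood in $r=r^1\otimes r^2\in\mathfrak{L}\otimes\mathfrak{L}$, and $\bar r=\bar r^1\otimes\bar r^2$ is a second copy of $r$. A (left) Leibniz algebra is a vector space with a bilinear bracket satisfying $[x,[y,z]]=[[x,y],z]+[y,[x,z]]$. For a Leibniz algebra $(\mathfrak{L},[,])$ and $r\in\mathfrak{L}\otimes\mathfrak{L}$, $\delta_r:\mathfrak{L}\to\mathfrak{L}\otimes\mathfrak{L}$ is $\delta_r(x)=-r^{1}\otimes [r^{2}, x]+[r^{2}, x]\otimes r^{1}+[x, r^{2}]\otimes r^{1}$. $(\mathfrak{L},[,],r,\delta_r)$ is called a triangular Leibniz bialgebra if $r$ is symmetric ($r^1\otimes r^2=r^2\otimes r^1$) and solves the classical Leibniz Yang-Baxter equation in $(\mathfrak{L},[,])$: $$r^1\otimes[r^2,\bar r^1]\otimes\bar r^2+r^1\otimes\bar r^1\otimes[r^2,\bar r^2]=[r^2,\bar r^1]\otimes r^1\otimes\bar r^2+[r^1,\bar r^2]\otimes\bar r^1\otimes r^2.$$ "All triangular Leibniz bialgebras on the given Leibniz algebra" means: these $r$ are exactly the symmetric solutions of this equation. *)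

theory Defs
  imports "HOL-Analysis.Analysis" "HOL-Library.Poly_Mapping"
begin

section \<open>Tensor product of real vector spaces\<close>

text \<open>
  The tensor product of \<open>'a\<close> and \<open>'b\<close> is the free real vector space on \<open>'a \<times> 'b\<close>
  modulo the subspace generated by the bilinearity relations.
\<close>

definition free_scale :: "real \<Rightarrow> ('k \<Rightarrow>\<^sub>0 real) \<Rightarrow> ('k \<Rightarrow>\<^sub>0 real)" where
  "free_scale c = Poly_Mapping.map ((*) c)"

lemma lookup_free_scale [simp]:
  "Poly_Mapping.lookup (free_scale c p) k = c * Poly_Mapping.lookup p k"
  by (simp add: free_scale_def Poly_Mapping.map.rep_eq when_def)

lemma free_scale_simps:
  "free_scale c (p + q) = free_scale c p + free_scale c q"
  "free_scale c (p - q) = free_scale c p - free_scale c q"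
  "free_scale (c + d) p = free_scale c p + free_scale d p"
  "free_scale c (free_scale d p) = free_scale (c * d) p"
  "free_scale 1 p = p"
  "free_scale 0 p = 0"
  "free_scale (- 1) p = - p"
  "free_scale c (Poly_Mapping.single k a) = Poly_Mapping.single k (c * a)"
  by (auto intro!: poly_mapping_eqI simp: lookup_add lookup_minus algebra_simps lookup_single when_def)

inductive tensor_null :: "(('a::real_vector \<times> 'b::real_vector) \<Rightarrow>\<^sub>0 real) \<Rightarrow> bool" where
  zero: "tensor_null 0"
| add: "tensor_null p \<Longrightarrow> tensor_null q \<Longrightarrow> tensor_null (p + q)"
| scale: "tensor_null p \<Longrightarrow> tensor_null (free_scale c p)"
| add_left: "tensor_null (Poly_Mapping.single (x + x', y) 1
    - Poly_Mapping.single (x, y) 1 - Poly_Mapping.single (x', y) 1)"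
| add_right: "tensor_null (Poly_Mapping.single (x, y + y') 1
    - Poly_Mapping.single (x, y) 1 - Poly_Mapping.single (x, y') 1)"
| scale_left: "tensor_null (Poly_Mapping.single (c *\<^sub>R x, y) 1 - Poly_Mapping.single (x, y) c)"
| scale_right: "tensor_null (Poly_Mapping.single (x, c *\<^sub>R y) 1 - Poly_Mapping.single (x, y) c)"

lemma tensor_null_uminus: "tensor_null p \<Longrightarrow> tensor_null (- p)"
  using tensor_null.scale[of p "- 1"] by (simp add: free_scale_simps)

lemma tensor_null_diff: "tensor_null p \<Longrightarrow> tensor_null q \<Longrightarrow> tensor_null (p - q)"
  using tensor_null.add[of p "- q"] tensor_null_uminus[of q] by simp

quotient_type (overloaded) ('a, 'b) tensor =
  "('a::real_vector \<times> 'b::real_vector) \<Rightarrow>\<^sub>0 real" / "\<lambda>p q. tensor_null (p - q)"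
proof (rule equivpI)
  show "reflp (\<lambda>p q. tensor_null (p - q))"
    by (simp add: reflp_def tensor_null.zero)
  show "symp (\<lambda>p q. tensor_null (p - q))"
    unfolding symp_def using tensor_null_uminus by fastforce
  show "transp (\<lambda>p q. tensor_null (p - q))"
    unfolding transp_def using tensor_null.add by fastforce
qed

instantiation tensor :: (real_vector, real_vector) real_vector
begin

lift_definition zero_tensor :: "('a, 'b) tensor" is 0 .

lift_definition plus_tensor :: "('a, 'b) tensor \<Rightarrow> ('a, 'b) tensor \<Rightarrow> ('a, 'b) tensor" is "(+)"
  unfolding add_diff_add by (rule tensor_null.add)

lift_definition uminus_tensor :: "('a, 'b) tensor \<Rightarrow> ('a, 'b) tensor" is uminus
  unfolding minus_diff_minus by (rule tensor_null_uminus)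

lift_definition minus_tensor :: "('a, 'b) tensor \<Rightarrow> ('a, 'b) tensor \<Rightarrow> ('a, 'b) tensor" is "(-)"
proof -
  fix p p' q q' :: "('a \<times> 'b) \<Rightarrow>\<^sub>0 real"
  assume "tensor_null (p - p')" "tensor_null (q - q')"
  then have "tensor_null ((p - p') - (q - q'))"
    by (rule tensor_null_diff)
  also have "(p - p') - (q - q') = (p - q) - (p' - q')"
    by (simp add: algebra_simps)
  finally show "tensor_null ((p - q) - (p' - q'))" .
qed

lift_definition scaleR_tensor :: "real \<Rightarrow> ('a, 'b) tensor \<Rightarrow> ('a, 'b) tensor" is free_scale
  unfolding free_scale_simps(2)[symmetric] by (rule tensor_null.scale)

instance
  by standard (transfer; simp add: free_scale_simps algebra_simps tensor_null.zero)+

end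

lift_definition tens :: "'a::real_vector \<Rightarrow> 'b::real_vector \<Rightarrow> ('a, 'b) tensor" (infixr "\<otimes>" 75)
  is "\<lambda>x y. Poly_Mapping.single (x, y) 1" .

lemma bilinear_tens: "bilinear (\<otimes>)"
  unfolding bilinear_def linear_iff
proof (intro conjI allI)
  fix x x' :: 'a and y y' :: 'b and c :: real
  show "x \<otimes> (y + y') = x \<otimes> y + x \<otimes> y'"
    by transfer (use tensor_null.add_right in \<open>simp add: diff_diff_add\<close>)
  show "(x + x') \<otimes> y = x \<otimes> y + x' \<otimes> y"
    by transfer (use tensor_null.add_left in \<open>simp add: diff_diff_add\<close>)
  show "x \<otimes> (c *\<^sub>R y) = c *\<^sub>R (x \<otimes> y)"
    by transfer (use tensor_null.scale_right in \<open>simp add: free_scale_simps\<close>)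
  show "(c *\<^sub>R x) \<otimes> y = c *\<^sub>R (x \<otimes> y)"
    by transfer (use tensor_null.scale_left in \<open>simp add: free_scale_simps\<close>)
qed

lemma tensor_induct [case_names tens add]:
  fixes t :: "('a::real_vector, 'b::real_vector) tensor"
  assumes tens: "\<And>x y. P (x \<otimes> y)"
    and add: "\<And>s t. P s \<Longrightarrow> P t \<Longrightarrow> P (s + t)"
  shows "P t"
proof -
  have step: "P (abs_tensor p)" for p :: "('a \<times> 'b) \<Rightarrow>\<^sub>0 real"
  proof (induction p rule: update_induct)
    case const
    have "abs_tensor (0 :: ('a \<times> 'b) \<Rightarrow>\<^sub>0 real) = 0 \<otimes> 0"
      using bilinear_lzero[OF bilinear_tens] by (metis zero_tensor.abs_eq)
    then show ?case using tens by metis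
  next
    case (update p k c)
    obtain x y where k: "k = (x, y)" by (cases k)
    have "Poly_Mapping.update k c p = free_scale c (Poly_Mapping.single k 1) + p"
      using update.hyps
      by (auto intro!: poly_mapping_eqI
          simp: lookup_update lookup_add lookup_single when_def in_keys_iff)
    then have "abs_tensor (Poly_Mapping.update k c p) = c *\<^sub>R (x \<otimes> y) + abs_tensor p"
      by (simp add: k plus_tensor.abs_eq scaleR_tensor.abs_eq tens.abs_eq)
    also have "c *\<^sub>R (x \<otimes> y) = (c *\<^sub>R x) \<otimes> y"
      by (simp add: bilinear_lmul[OF bilinear_tens])
    finally show ?case using tens add update.IH by metis
  qed
  show ?thesis using step by (metis Quotient_abs_rep[OF Quotient_tensor])
qed

definition free_eval ::
  "('a::real_vector \<Rightarrow> 'b::real_vector \<Rightarrow> 'c::real_vector) \<Rightarrow> (('a \<times> 'b) \<Rightarrow>\<^sub>0 real) \<Rightarrow> 'c" where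
  "free_eval B p = (\<Sum>(x, y)\<in>Poly_Mapping.keys p. Poly_Mapping.lookup p (x, y) *\<^sub>R B x y)"

lemma free_eval_superset:
  assumes "finite K" "Poly_Mapping.keys p \<subseteq> K"
  shows "free_eval B p = (\<Sum>(x, y)\<in>K. Poly_Mapping.lookup p (x, y) *\<^sub>R B x y)"
  unfolding free_eval_def
  by (rule sum.mono_neutral_left) (use assms in \<open>auto simp: in_keys_iff\<close>)

lemma free_eval_add: "free_eval B (p + q) = free_eval B p + free_eval B q"
proof -
  let ?K = "Poly_Mapping.keys p \<union> Poly_Mapping.keys q"
  have "Poly_Mapping.keys (p + q) \<subseteq> ?K" by (rule Poly_Mapping.keys_add)
  then show ?thesis
    by (simp add: free_eval_superset[of ?K] lookup_add scaleR_add_left sum.distrib case_prod_unfold)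
qed

lemma free_eval_scale: "free_eval B (free_scale c p) = c *\<^sub>R free_eval B p"
proof -
  have "Poly_Mapping.keys (free_scale c p) \<subseteq> Poly_Mapping.keys p"
    by (auto simp: in_keys_iff)
  then show ?thesis
    by (simp add: free_eval_superset[of "Poly_Mapping.keys p"] scaleR_sum_right case_prod_unfold)
qed

lemma free_eval_diff: "free_eval B (p - q) = free_eval B p - free_eval B q"
  using free_eval_add[of B p "- q"] free_eval_scale[of B "- 1" q] by (simp add: free_scale_simps)

lemma free_eval_single: "free_eval B (Poly_Mapping.single (x, y) c) = c *\<^sub>R B x y"
  by (simp add: free_eval_def)

lemma free_eval_tensor_null: "tensor_null p \<Longrightarrow> bilinear B \<Longrightarrow> free_eval B p = 0"
  by (induction rule: tensor_null.induct)
    (auto simp: free_eval_add free_eval_diff free_eval_scale free_eval_single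
      bilinear_ladd bilinear_radd bilinear_lmul bilinear_rmul, simp add: free_eval_def)

text \<open>
  The linear map induced by a bilinear map. For bilinear \<open>B\<close>, \<open>tensor_lift B r\<close> is what Sweedler
  notation writes as \<open>B r\<^sup>1 r\<^sup>2\<close> with summation understood; for \<open>B\<close> not bilinear the value \<open>0\<close>
  is junk.
\<close>

lift_definition tensor_lift ::
  "('a::real_vector \<Rightarrow> 'b::real_vector \<Rightarrow> 'c::real_vector) \<Rightarrow> ('a, 'b) tensor \<Rightarrow> 'c"
  is "\<lambda>B p. if bilinear B then free_eval B p else 0"
  using free_eval_tensor_null by (fastforce simp: free_eval_diff)

lemma tensor_lift_tens: "bilinear B \<Longrightarrow> tensor_lift B (x \<otimes> y) = B x y"
  by transfer (simp add: free_eval_single)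

lemma linear_tensor_lift: "linear (tensor_lift B)"
  unfolding linear_iff by (transfer, simp add: free_eval_add free_eval_scale)

lemma tensor_lift_unique:
  assumes "bilinear B" "linear f" "\<And>x y. f (x \<otimes> y) = B x y"
  shows "f = tensor_lift B"
proof
  fix t show "f t = tensor_lift B t"
    by (induction t rule: tensor_induct)
      (simp_all add: assms tensor_lift_tens linear_add linear_tensor_lift)
qed


section \<open>Triangular Leibniz bialgebras\<close>

definition leibniz_algebra :: "('a::real_vector \<Rightarrow> 'a \<Rightarrow> 'a) \<Rightarrow> bool" where
  "leibniz_algebra br \<longleftrightarrow> bilinear br \<and>
     (\<forall>x y z. br x (br y z) = br (br x y) z + br y (br x z))"

definition symmetric_tensor :: "('a::real_vector, 'a) tensor \<Rightarrow> bool" where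
  "symmetric_tensor r \<longleftrightarrow> r = tensor_lift (\<lambda>r1 r2. r2 \<otimes> r1) r"

definition cobracket ::
  "('a::real_vector \<Rightarrow> 'a \<Rightarrow> 'a) \<Rightarrow> ('a, 'a) tensor \<Rightarrow> 'a \<Rightarrow> ('a, 'a) tensor" where
  "cobracket br r x =
     tensor_lift (\<lambda>r1 r2. - (r1 \<otimes> br r2 x) + br r2 x \<otimes> r1 + br x r2 \<otimes> r1) r"

text \<open>
  The two nested lifts range over the two copies of \<open>r\<close>; the triple tensor product is
  associated to the right.
\<close>

definition classical_leibniz_YBE ::
  "('a::real_vector \<Rightarrow> 'a \<Rightarrow> 'a) \<Rightarrow> ('a, 'a) tensor \<Rightarrow> bool" where
  "classical_leibniz_YBE br r \<longleftrightarrow>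
     tensor_lift (\<lambda>r1 r2. tensor_lift (\<lambda>s1 s2.
       r1 \<otimes> br r2 s1 \<otimes> s2 + r1 \<otimes> s1 \<otimes> br r2 s2) r) r =
     tensor_lift (\<lambda>r1 r2. tensor_lift (\<lambda>s1 s2.
       br r2 s1 \<otimes> r1 \<otimes> s2 + br r1 s2 \<otimes> s1 \<otimes> r2) r) r"

definition triangular_leibniz_bialgebra ::
  "('a::real_vector \<Rightarrow> 'a \<Rightarrow> 'a) \<Rightarrow> ('a, 'a) tensor \<Rightarrow> ('a \<Rightarrow> ('a, 'a) tensor) \<Rightarrow> bool" where
  "triangular_leibniz_bialgebra br r \<delta> \<longleftrightarrow>
     leibniz_algebra br \<and> \<delta> = cobracket br r \<and>
     symmetric_tensor r \<and> classical_leibniz_YBE br r"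

end

theory Submission
  imports Defs
begin

text \<open>
  Let \<open>\<alpha>, \<beta>\<close> be the basis of functionals dual to \<open>e, f\<close>. Both brackets have values in the line
  spanned by \<open>e\<close> and ignore the \<open>e\<close>-component of their first argument, so both have the form
  \<open>[x, y] = \<beta>(x) \<sigma>(y) e\<close> with a functional \<open>\<sigma>\<close>: in (a) \<open>\<sigma> = \<beta>\<close>, in (b) \<open>\<sigma> = \<alpha> + \<beta>\<close>. The locale
  \<open>rank_one_bracket\<close> treats all such brackets at once. As \<open>\<beta> e = 0\<close>, all of them are Leibniz.

  Only two vectors enter the equations that \<open>r\<close> has to satisfy, namely the contractions
  \<open>u = r\<^sup>1 \<beta>(r\<^sup>2)\<close> and \<open>v = r\<^sup>1 \<sigma>(r\<^sup>2)\<close>. For symmetric \<open>r\<close> the Yang-Baxter equation becomes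
  \<open>u \<otimes> e \<otimes> v + u \<otimes> v \<otimes> e = e \<otimes> u \<otimes> v + e \<otimes> v \<otimes> u\<close>.
  Applying \<open>\<beta>\<close> to the first factor kills the right-hand side and leaves
  \<open>\<beta>(u) (e \<otimes> v + v \<otimes> e) = 0\<close>; since \<open>e \<otimes> v + v \<otimes> e\<close> vanishes only for \<open>v = 0\<close>, it follows that
  \<open>\<beta>(u) = 0\<close> or \<open>v = 0\<close>. Conversely, if \<open>\<beta>(u) = 0\<close> then \<open>u\<close> is a multiple of \<open>e\<close> and both sides
  agree, and if \<open>v = 0\<close> both sides are zero (lemma \<open>classical_leibniz_YBE_iff\<close>). In coordinates
  this alternative gives the two families: \<open>\<beta>(u)\<close> is the coefficient of \<open>f \<otimes> f\<close> in \<open>r\<close>, and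
  the symmetric \<open>r\<close> with \<open>v = 0\<close> are, in (b), the multiples of \<open>(e - f) \<otimes> (e - f)\<close>,
  whereas in (a) they already have no \<open>f \<otimes> f\<close> term. The cobracket is also determined by \<open>u\<close> and
  \<open>v\<close> (lemma \<open>cobracket_eq\<close>).
\<close>

section \<open>Contractions of tensors by linear functionals\<close>

lemmas tens_simps =
  bilinear_ladd[OF bilinear_tens] bilinear_radd[OF bilinear_tens]
  bilinear_lmul[OF bilinear_tens] bilinear_rmul[OF bilinear_tens]
  bilinear_lzero[OF bilinear_tens] bilinear_rzero[OF bilinear_tens]
  bilinear_lneg[OF bilinear_tens] bilinear_rneg[OF bilinear_tens]
  bilinear_lsub[OF bilinear_tens] bilinear_rsub[OF bilinear_tens]

lemmas tensor_lift_linear_simps =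
  linear_add[OF linear_tensor_lift] linear_cmul[OF linear_tensor_lift]
  linear_0[OF linear_tensor_lift] linear_neg[OF linear_tensor_lift]
  linear_diff[OF linear_tensor_lift]

text \<open>
  The universal property as a calculation rule: a Sweedler expression with bilinear integrand is
  evaluated by guessing a linear map with the right values on pure tensors.
\<close>

lemma tensor_lift_eq_linear:
  assumes "linear L" "\<And>x y. L (x \<otimes> y) = B x y"
  shows "tensor_lift B t = L t"
proof -
  have L: "L (s + t) = L s + L t" "L (c *\<^sub>R t) = c *\<^sub>R L t" for s t c
    using assms(1) by (simp_all add: linear_add linear_cmul)
  have "bilinear B"
    unfolding bilinear_def linear_iff
    by (simp add: assms(2)[symmetric] tens_simps L)
  then show ?thesis
    using tensor_lift_unique[of B L] assms by simp
qed

definition contract_left :: "('a::real_vector \<Rightarrow> real) \<Rightarrow> ('a, 'b::real_vector) tensor \<Rightarrow> 'b" where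
  "contract_left \<phi> = tensor_lift (\<lambda>x y. \<phi> x *\<^sub>R y)"

definition contract_right :: "('b::real_vector \<Rightarrow> real) \<Rightarrow> ('a::real_vector, 'b) tensor \<Rightarrow> 'a" where
  "contract_right \<phi> = tensor_lift (\<lambda>x y. \<phi> y *\<^sub>R x)"

lemma linear_contract_left: "linear (contract_left \<phi>)"
  by (simp add: contract_left_def linear_tensor_lift)

lemma linear_contract_right: "linear (contract_right \<phi>)"
  by (simp add: contract_right_def linear_tensor_lift)

lemmas contract_linear_simps =
  linear_add[OF linear_contract_left] linear_cmul[OF linear_contract_left]
  linear_0[OF linear_contract_left]
  linear_add[OF linear_contract_right] linear_cmul[OF linear_contract_right]
  linear_0[OF linear_contract_right]

lemma contract_left_tens: "linear \<phi> \<Longrightarrow> contract_left \<phi> (x \<otimes> y) = \<phi> x *\<^sub>R y"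
  unfolding contract_left_def
  by (rule tensor_lift_tens)
    (simp add: bilinear_def linear_iff scaleR_add_left scaleR_add_right)

lemma contract_right_tens: "linear \<phi> \<Longrightarrow> contract_right \<phi> (x \<otimes> y) = \<phi> y *\<^sub>R x"
  unfolding contract_right_def
  by (rule tensor_lift_tens)
    (simp add: bilinear_def linear_iff scaleR_add_left scaleR_add_right)

lemma bilinear_flip_tens: "bilinear (\<lambda>x y. y \<otimes> x)"
  by (simp add: bilinear_def linear_iff tens_simps)

text \<open>Flipping the two factors exchanges the left and the right contraction.\<close>

lemma contract_left_eq_right_if_symmetric:
  assumes "symmetric_tensor r" "linear \<phi>"
  shows "contract_left \<phi> r = contract_right \<phi> r"
proof -
  have "contract_right \<phi> r = contract_left \<phi> (tensor_lift (\<lambda>x y. y \<otimes> x) r)"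
    unfolding contract_right_def
    by (rule tensor_lift_eq_linear)
      (simp_all add: linear_iff tensor_lift_linear_simps contract_linear_simps
        tensor_lift_tens[OF bilinear_flip_tens] contract_left_tens[OF assms(2)])
  then show ?thesis
    using assms(1) by (simp add: symmetric_tensor_def)
qed

text \<open>Contracting with a functional \<open>\<phi>\<close> such that \<open>\<phi> e = 1\<close> gives \<open>v = - \<phi>(v) e\<close>, and applying
  \<open>\<phi>\<close> again gives \<open>2 \<phi>(v) = 0\<close>.\<close>

lemma symmetrized_tens_eq_0D:
  fixes e v :: "'a::real_vector" and \<phi> :: "'a \<Rightarrow> real"
  assumes "linear \<phi>" "\<phi> e = 1" "e \<otimes> v + v \<otimes> e = 0"
  shows "v = 0"
proof -
  have "contract_left \<phi> (e \<otimes> v + v \<otimes> e) = 0"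
    by (simp add: assms(3) contract_linear_simps)
  then have v: "v + \<phi> v *\<^sub>R e = 0"
    by (simp add: contract_linear_simps contract_left_tens[OF assms(1)] assms(2))
  then have "\<phi> (v + \<phi> v *\<^sub>R e) = 0"
    using assms(1) by (simp add: linear_0)
  then have "\<phi> v = 0"
    using assms(1,2) by (simp add: linear_add linear_cmul)
  then show ?thesis using v by simp
qed


section \<open>Rank one Leibniz brackets on the plane\<close>

locale rank_one_bracket =
  fixes e f :: "'a::real_vector" and \<alpha> \<beta> \<sigma> :: "'a \<Rightarrow> real" and br :: "'a \<Rightarrow> 'a \<Rightarrow> 'a"
  assumes linear_functionals: "linear \<alpha>" "linear \<beta>" "linear \<sigma>"
    and dual [simp]: "\<alpha> e = 1" "\<alpha> f = 0" "\<beta> e = 0" "\<beta> f = 1"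
    and expand: "x = \<alpha> x *\<^sub>R e + \<beta> x *\<^sub>R f"
    and br: "br x y = (\<beta> x * \<sigma> y) *\<^sub>R e"
begin

lemmas functional_simps =
  linear_functionals[THEN linear_add] linear_functionals[THEN linear_cmul]
  linear_functionals[THEN linear_0]

lemma leibniz: "leibniz_algebra br"
  by (simp add: leibniz_algebra_def br bilinear_def linear_iff functional_simps algebra_simps)

lemma cobracket_eq:
  "cobracket br r x =
     \<sigma> x *\<^sub>R (e \<otimes> contract_right \<beta> r - contract_right \<beta> r \<otimes> e) +
     \<beta> x *\<^sub>R (e \<otimes> contract_right \<sigma> r)"
  unfolding cobracket_def
  by (rule tensor_lift_eq_linear)
    (simp_all add: linear_iff contract_linear_simps linear_functionals[THEN contract_right_tens]
      br tens_simps algebra_simps)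

text \<open>
  In each term of the Yang-Baxter equation the bracket takes one leg from each copy of \<open>r\<close> and
  replaces the pair by \<open>e\<close> times the values of \<open>\<beta>\<close> and \<open>\<sigma>\<close> on these legs. The remaining leg of
  each copy is thereby contracted independently, on the side that its position in \<open>r\<close> dictates.
\<close>

lemma YBE_lhs_eq:
  "tensor_lift (\<lambda>r1 r2. tensor_lift (\<lambda>s1 s2.
      r1 \<otimes> br r2 s1 \<otimes> s2 + r1 \<otimes> s1 \<otimes> br r2 s2) r) r =
   contract_right \<beta> r \<otimes> e \<otimes> contract_left \<sigma> r + contract_right \<beta> r \<otimes> contract_right \<sigma> r \<otimes> e"
proof -
  have inner: "tensor_lift (\<lambda>s1 s2. r1 \<otimes> br r2 s1 \<otimes> s2 + r1 \<otimes> s1 \<otimes> br r2 s2) r =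
      \<beta> r2 *\<^sub>R (r1 \<otimes> e \<otimes> contract_left \<sigma> r + r1 \<otimes> contract_right \<sigma> r \<otimes> e)" for r1 r2
    by (rule tensor_lift_eq_linear)
      (simp_all add: linear_iff contract_linear_simps linear_functionals[THEN contract_right_tens]
        linear_functionals[THEN contract_left_tens] br tens_simps algebra_simps)
  show ?thesis
    unfolding inner
    by (rule tensor_lift_eq_linear
        [where L = "\<lambda>t. contract_right \<beta> t \<otimes> e \<otimes> contract_left \<sigma> r +
           contract_right \<beta> t \<otimes> contract_right \<sigma> r \<otimes> e"])
      (simp_all add: linear_iff contract_linear_simps linear_functionals[THEN contract_right_tens]
        tens_simps algebra_simps)
qed

lemma YBE_rhs_eq:
  "tensor_lift (\<lambda>r1 r2. tensor_lift (\<lambda>s1 s2.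
      br r2 s1 \<otimes> r1 \<otimes> s2 + br r1 s2 \<otimes> s1 \<otimes> r2) r) r =
   e \<otimes> contract_right \<beta> r \<otimes> contract_left \<sigma> r + e \<otimes> contract_right \<sigma> r \<otimes> contract_left \<beta> r"
proof -
  have inner: "tensor_lift (\<lambda>s1 s2. br r2 s1 \<otimes> r1 \<otimes> s2 + br r1 s2 \<otimes> s1 \<otimes> r2) r =
      \<beta> r2 *\<^sub>R (e \<otimes> r1 \<otimes> contract_left \<sigma> r) + \<beta> r1 *\<^sub>R (e \<otimes> contract_right \<sigma> r \<otimes> r2)" for r1 r2
    by (rule tensor_lift_eq_linear)
      (simp_all add: linear_iff contract_linear_simps linear_functionals[THEN contract_right_tens]
        linear_functionals[THEN contract_left_tens] br tens_simps algebra_simps)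
  show ?thesis
    unfolding inner
    by (rule tensor_lift_eq_linear
        [where L = "\<lambda>t. e \<otimes> contract_right \<beta> t \<otimes> contract_left \<sigma> r +
           e \<otimes> contract_right \<sigma> r \<otimes> contract_left \<beta> t"])
      (simp_all add: linear_iff contract_linear_simps linear_functionals[THEN contract_right_tens]
        linear_functionals[THEN contract_left_tens] tens_simps algebra_simps)
qed

text \<open>
  The first factor of every term on the right-hand side is \<open>e\<close>, which \<open>\<beta>\<close> annihilates; this is
  why contracting the first factor with \<open>\<beta>\<close> decides the equation.
\<close>

lemma classical_leibniz_YBE_iff:
  assumes "symmetric_tensor r"
  shows "classical_leibniz_YBE br r \<longleftrightarrow>
    \<beta> (contract_right \<beta> r) = 0 \<or> contract_right \<sigma> r = 0"
proof -
  define u v where "u = contract_right \<beta> r" and "v = contract_right \<sigma> r"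
  have ybe: "classical_leibniz_YBE br r \<longleftrightarrow>
      u \<otimes> e \<otimes> v + u \<otimes> v \<otimes> e = e \<otimes> u \<otimes> v + e \<otimes> v \<otimes> u"
    unfolding classical_leibniz_YBE_def YBE_lhs_eq YBE_rhs_eq u_def v_def
    by (simp add: contract_left_eq_right_if_symmetric[OF assms] linear_functionals)
  have "\<beta> u = 0 \<or> v = 0" if "u \<otimes> e \<otimes> v + u \<otimes> v \<otimes> e = e \<otimes> u \<otimes> v + e \<otimes> v \<otimes> u"
  proof -
    have "\<beta> u *\<^sub>R (e \<otimes> v + v \<otimes> e) = 0"
      using arg_cong[OF that, of "contract_left \<beta>"]
      by (simp add: contract_linear_simps linear_functionals[THEN contract_left_tens]
          scaleR_add_right)
    then show ?thesis
      using symmetrized_tens_eq_0D[of \<alpha> e v] linear_functionals by auto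
  qed
  moreover have "u \<otimes> e \<otimes> v + u \<otimes> v \<otimes> e = e \<otimes> u \<otimes> v + e \<otimes> v \<otimes> u" if "\<beta> u = 0"
  proof -
    have "u = \<alpha> u *\<^sub>R e" using expand[of u, symmetric] that by simp
    then obtain k where "u = k *\<^sub>R e" by blast
    then show ?thesis by (simp add: tens_simps)
  qed
  moreover have "u \<otimes> e \<otimes> v + u \<otimes> v \<otimes> e = e \<otimes> u \<otimes> v + e \<otimes> v \<otimes> u" if "v = 0"
    using that by (simp add: tens_simps)
  ultimately show ?thesis
    using ybe by (auto simp: u_def v_def)
qed


section \<open>Triangular structures in coordinates\<close>

definition tensor_of_coords :: "real \<Rightarrow> real \<Rightarrow> real \<Rightarrow> real \<Rightarrow> ('a, 'a) tensor" where
  "tensor_of_coords a b c d =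
     a *\<^sub>R (e \<otimes> e) + b *\<^sub>R (e \<otimes> f) + c *\<^sub>R (f \<otimes> e) + d *\<^sub>R (f \<otimes> f)"

lemma ex_tensor_of_coords: "\<exists>a b c d. r = tensor_of_coords a b c d"
proof (induction r rule: tensor_induct)
  case (tens x y)
  have "x \<otimes> y = (\<alpha> x *\<^sub>R e + \<beta> x *\<^sub>R f) \<otimes> (\<alpha> y *\<^sub>R e + \<beta> y *\<^sub>R f)"
    by (simp add: expand[symmetric])
  also have "\<dots> = tensor_of_coords (\<alpha> x * \<alpha> y) (\<alpha> x * \<beta> y) (\<beta> x * \<alpha> y) (\<beta> x * \<beta> y)"
    by (simp add: tensor_of_coords_def tens_simps algebra_simps)
  finally show ?case by blast
next
  case (add s t)
  then obtain a b c d a' b' c' d' where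
    "s = tensor_of_coords a b c d" "t = tensor_of_coords a' b' c' d'" by blast
  then have "s + t = tensor_of_coords (a + a') (b + b') (c + c') (d + d')"
    by (simp add: tensor_of_coords_def algebra_simps)
  then show ?case by blast
qed

lemma contract_right_coords:
  assumes "linear \<phi>"
  shows "contract_right \<phi> (tensor_of_coords a b c d) =
    (a * \<phi> e + b * \<phi> f) *\<^sub>R e + (c * \<phi> e + d * \<phi> f) *\<^sub>R f"
  by (simp add: tensor_of_coords_def contract_linear_simps contract_right_tens[OF assms]
      algebra_simps)

lemma contract_left_coords:
  assumes "linear \<phi>"
  shows "contract_left \<phi> (tensor_of_coords a b c d) =
    (a * \<phi> e + c * \<phi> f) *\<^sub>R e + (b * \<phi> e + d * \<phi> f) *\<^sub>R f"
  by (simp add: tensor_of_coords_def contract_linear_simps contract_left_tens[OF assms]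
      algebra_simps)

lemma coords_eq_0_iff: "x *\<^sub>R e + y *\<^sub>R f = 0 \<longleftrightarrow> x = 0 \<and> y = 0"
proof
  assume *: "x *\<^sub>R e + y *\<^sub>R f = 0"
  have "\<alpha> (x *\<^sub>R e + y *\<^sub>R f) = 0" "\<beta> (x *\<^sub>R e + y *\<^sub>R f) = 0"
    unfolding * by (simp_all add: functional_simps)
  then show "x = 0 \<and> y = 0" by (simp add: functional_simps)
qed simp

lemma symmetric_tensor_of_coords_iff: "symmetric_tensor (tensor_of_coords a b c d) \<longleftrightarrow> b = c"
proof
  assume "symmetric_tensor (tensor_of_coords a b c d)"
  then have "\<alpha> (contract_left \<beta> (tensor_of_coords a b c d)) =
      \<alpha> (contract_right \<beta> (tensor_of_coords a b c d))"
    by (simp add: contract_left_eq_right_if_symmetric linear_functionals)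
  then show "b = c"
    by (simp add: contract_left_coords contract_right_coords linear_functionals functional_simps)
next
  assume "b = c"
  then show "symmetric_tensor (tensor_of_coords a b c d)"
    by (simp add: symmetric_tensor_def tensor_of_coords_def tensor_lift_linear_simps
        tensor_lift_tens[OF bilinear_flip_tens])
qed

text \<open>The disjunction is \<open>classical_leibniz_YBE_iff\<close>: here \<open>\<beta>(u) = d\<close>, and the last two equations
  say \<open>v = 0\<close>.\<close>

lemma triangular_iff:
  "triangular_leibniz_bialgebra br (tensor_of_coords a b c d)
      (cobracket br (tensor_of_coords a b c d)) \<longleftrightarrow>
    b = c \<and> (d = 0 \<or> a * \<sigma> e + b * \<sigma> f = 0 \<and> c * \<sigma> e + d * \<sigma> f = 0)"
proof -
  have "\<beta> (contract_right \<beta> (tensor_of_coords a b c d)) = d"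
    by (simp add: contract_right_coords linear_functionals functional_simps)
  moreover have "contract_right \<sigma> (tensor_of_coords a b c d) = 0 \<longleftrightarrow>
      a * \<sigma> e + b * \<sigma> f = 0 \<and> c * \<sigma> e + d * \<sigma> f = 0"
    by (simp add: contract_right_coords linear_functionals coords_eq_0_iff)
  ultimately show ?thesis
    using classical_leibniz_YBE_iff[of "tensor_of_coords a b c d"]
    by (auto simp: triangular_leibniz_bialgebra_def leibniz symmetric_tensor_of_coords_iff)
qed

lemma cobracket_coords:
  "cobracket br (tensor_of_coords a b c d) e =
     \<sigma> e *\<^sub>R (d *\<^sub>R (e \<otimes> f) - d *\<^sub>R (f \<otimes> e))"
  "cobracket br (tensor_of_coords a b c d) f =
     \<sigma> f *\<^sub>R (d *\<^sub>R (e \<otimes> f) - d *\<^sub>R (f \<otimes> e)) +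
     (a * \<sigma> e + b * \<sigma> f) *\<^sub>R (e \<otimes> e) + (c * \<sigma> e + d * \<sigma> f) *\<^sub>R (e \<otimes> f)"
  by (simp_all add: cobracket_eq contract_right_coords linear_functionals tens_simps algebra_simps)

lemma coords_family_1:
  "\<mu> *\<^sub>R (e \<otimes> e) + \<gamma> *\<^sub>R (e \<otimes> f) + \<gamma> *\<^sub>R (f \<otimes> e) = tensor_of_coords \<mu> \<gamma> \<gamma> 0"
  by (simp add: tensor_of_coords_def)

lemma coords_family_2:
  "\<mu> *\<^sub>R (e \<otimes> e) - \<mu> *\<^sub>R (e \<otimes> f) - \<mu> *\<^sub>R (f \<otimes> e) + \<mu> *\<^sub>R (f \<otimes> f) =
    tensor_of_coords \<mu> (- \<mu>) (- \<mu>) \<mu>"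
  by (simp add: tensor_of_coords_def)

end

lemma dual_basis_exists:
  fixes e f :: "'a::real_vector"
  assumes "e \<noteq> f" and "independent {e, f}" and "span {e, f} = UNIV"
  obtains \<alpha> \<beta> :: "'a \<Rightarrow> real" where "linear \<alpha>" "linear \<beta>"
    "\<alpha> e = 1" "\<alpha> f = 0" "\<beta> e = 0" "\<beta> f = 1" "\<And>x. x = \<alpha> x *\<^sub>R e + \<beta> x *\<^sub>R f"
proof -
  obtain \<alpha> :: "'a \<Rightarrow> real" where \<alpha>: "linear \<alpha>" "\<alpha> e = 1" "\<alpha> f = 0"
    using linear_independent_extend[OF assms(2), of "\<lambda>x. if x = e then 1 else 0"] assms(1) by auto
  obtain \<beta> :: "'a \<Rightarrow> real" where \<beta>: "linear \<beta>" "\<beta> e = 0" "\<beta> f = 1"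
    using linear_independent_extend[OF assms(2), of "\<lambda>x. if x = f then 1 else 0"] assms(1) by auto
  have "x = \<alpha> x *\<^sub>R e + \<beta> x *\<^sub>R f" for x
  proof -
    have "x \<in> span {e, f}" using assms(3) by simp
    then obtain k l where "x = k *\<^sub>R e + l *\<^sub>R f"
      by (auto simp: span_breakdown_eq algebra_simps)
    then show ?thesis
      using \<alpha> \<beta> by (simp add: linear_add linear_cmul)
  qed
  then show ?thesis using that \<alpha> \<beta> by blast
qed


section \<open>The classification\<close>

theorem theorem4p1:
  fixes e f :: "'a::real_vector"
  assumes "e \<noteq> f" and "independent {e, f}" and "span {e, f} = UNIV"
  shows
    "(\<forall>br. bilinear br \<and> br e e = 0 \<and> br e f = 0 \<and> br f e = 0 \<and> br f f = e \<longrightarrow>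
        leibniz_algebra br \<and>
        {r. triangular_leibniz_bialgebra br r (cobracket br r)} =
          {\<mu> *\<^sub>R (e \<otimes> e) + \<gamma> *\<^sub>R (e \<otimes> f) + \<gamma> *\<^sub>R (f \<otimes> e) | \<mu> \<gamma>. True} \<and>
        (\<forall>\<mu> \<gamma> r. r = \<mu> *\<^sub>R (e \<otimes> e) + \<gamma> *\<^sub>R (e \<otimes> f) + \<gamma> *\<^sub>R (f \<otimes> e) \<longrightarrow>
          cobracket br r e = 0 \<and>
          cobracket br r f = \<gamma> *\<^sub>R (e \<otimes> e))) \<and>
     (\<forall>br. bilinear br \<and> br e e = 0 \<and> br e f = 0 \<and> br f e = e \<and> br f f = e \<longrightarrow>
        leibniz_algebra br \<and>
        {r. triangular_leibniz_bialgebra br r (cobracket br r)} =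
          {\<mu> *\<^sub>R (e \<otimes> e) + \<gamma> *\<^sub>R (e \<otimes> f) + \<gamma> *\<^sub>R (f \<otimes> e) | \<mu> \<gamma>. True} \<union>
          {\<mu> *\<^sub>R (e \<otimes> e) - \<mu> *\<^sub>R (e \<otimes> f) - \<mu> *\<^sub>R (f \<otimes> e) + \<mu> *\<^sub>R (f \<otimes> f) | \<mu>. True} \<and>
        (\<forall>\<mu> \<gamma> r. r = \<mu> *\<^sub>R (e \<otimes> e) + \<gamma> *\<^sub>R (e \<otimes> f) + \<gamma> *\<^sub>R (f \<otimes> e) \<longrightarrow>
          cobracket br r e = 0 \<and>
          cobracket br r f = (\<mu> + \<gamma>) *\<^sub>R (e \<otimes> e) + \<gamma> *\<^sub>R (e \<otimes> f)) \<and>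
        (\<forall>\<mu> r. r = \<mu> *\<^sub>R (e \<otimes> e) - \<mu> *\<^sub>R (e \<otimes> f) - \<mu> *\<^sub>R (f \<otimes> e) + \<mu> *\<^sub>R (f \<otimes> f) \<longrightarrow>
          cobracket br r e = \<mu> *\<^sub>R (e \<otimes> f - f \<otimes> e) \<and>
          cobracket br r f = \<mu> *\<^sub>R (e \<otimes> f - f \<otimes> e)))"
proof -
  obtain \<alpha> \<beta> :: "'a \<Rightarrow> real" where lin: "linear \<alpha>" "linear \<beta>"
    and dual: "\<alpha> e = 1" "\<alpha> f = 0" "\<beta> e = 0" "\<beta> f = 1"
    and expand: "\<And>x. x = \<alpha> x *\<^sub>R e + \<beta> x *\<^sub>R f"
    using dual_basis_exists[OF assms] by blast
  have br_expand: "br x y = (\<alpha> x * \<alpha> y) *\<^sub>R br e e + (\<alpha> x * \<beta> y) *\<^sub>R br e f +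
      (\<beta> x * \<alpha> y) *\<^sub>R br f e + (\<beta> x * \<beta> y) *\<^sub>R br f f"
    if "bilinear br" for br :: "'a \<Rightarrow> 'a \<Rightarrow> 'a" and x y
  proof -
    have "br x y = br (\<alpha> x *\<^sub>R e + \<beta> x *\<^sub>R f) (\<alpha> y *\<^sub>R e + \<beta> y *\<^sub>R f)"
      by (simp add: expand[symmetric])
    then show ?thesis
      by (simp add: bilinear_ladd[OF that] bilinear_radd[OF that] bilinear_lmul[OF that]
          bilinear_rmul[OF that] algebra_simps)
  qed
  show ?thesis
  proof (rule conjI; intro allI impI; elim conjE)
    fix br :: "'a \<Rightarrow> 'a \<Rightarrow> 'a"
    assume br: "bilinear br" "br e e = 0" "br e f = 0" "br f e = 0" "br f f = e"
    interpret rank_one_bracket e f \<alpha> \<beta> \<beta> br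
    proof (rule rank_one_bracket.intro)
      show "x = \<alpha> x *\<^sub>R e + \<beta> x *\<^sub>R f" for x by (rule expand)
      show "br x y = (\<beta> x * \<beta> y) *\<^sub>R e" for x y
        using br_expand[OF br(1), of x y] by (simp add: br(2-))
    qed (use lin dual in auto)
    have "{r. triangular_leibniz_bialgebra br r (cobracket br r)} =
        {tensor_of_coords \<mu> \<gamma> \<gamma> 0 | \<mu> \<gamma>. True}" (is "?T = ?F")
    proof (intro subset_antisym subsetI)
      fix r assume r: "r \<in> ?T"
      obtain a b c d where "r = tensor_of_coords a b c d" using ex_tensor_of_coords by blast
      with r show "r \<in> ?F" by (auto simp: triangular_iff)
    qed (auto simp: triangular_iff)
    then show "leibniz_algebra br \<and>
        {r. triangular_leibniz_bialgebra br r (cobracket br r)} =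
          {\<mu> *\<^sub>R (e \<otimes> e) + \<gamma> *\<^sub>R (e \<otimes> f) + \<gamma> *\<^sub>R (f \<otimes> e) | \<mu> \<gamma>. True} \<and>
        (\<forall>\<mu> \<gamma> r. r = \<mu> *\<^sub>R (e \<otimes> e) + \<gamma> *\<^sub>R (e \<otimes> f) + \<gamma> *\<^sub>R (f \<otimes> e) \<longrightarrow>
          cobracket br r e = 0 \<and>
          cobracket br r f = \<gamma> *\<^sub>R (e \<otimes> e))"
      unfolding coords_family_1 by (simp add: leibniz cobracket_coords)
  next
    fix br :: "'a \<Rightarrow> 'a \<Rightarrow> 'a"
    assume br: "bilinear br" "br e e = 0" "br e f = 0" "br f e = e" "br f f = e"
    interpret rank_one_bracket e f \<alpha> \<beta> "\<lambda>x. \<alpha> x + \<beta> x" br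
    proof (rule rank_one_bracket.intro)
      show "x = \<alpha> x *\<^sub>R e + \<beta> x *\<^sub>R f" for x by (rule expand)
      show "br x y = (\<beta> x * (\<alpha> y + \<beta> y)) *\<^sub>R e" for x y
        using br_expand[OF br(1), of x y] by (simp add: br(2-) algebra_simps)
    qed (use lin dual in \<open>auto intro: linear_compose_add\<close>)
    have "{r. triangular_leibniz_bialgebra br r (cobracket br r)} =
        {tensor_of_coords \<mu> \<gamma> \<gamma> 0 | \<mu> \<gamma>. True} \<union>
        {tensor_of_coords \<mu> (- \<mu>) (- \<mu>) \<mu> | \<mu>. True}" (is "?T = ?F")
    proof (intro subset_antisym subsetI)
      fix r assume r: "r \<in> ?T"
      obtain a b c d where coords: "r = tensor_of_coords a b c d"
        using ex_tensor_of_coords by blast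
      with r have "b = c \<and> (d = 0 \<or> a + b = 0 \<and> c + d = 0)"
        by (auto simp: triangular_iff)
      then have "b = c \<and> d = 0 \<or> a = d \<and> b = - d \<and> c = - d" by auto
      with coords show "r \<in> ?F" by blast
    qed (auto simp: triangular_iff)
    then show "leibniz_algebra br \<and>
        {r. triangular_leibniz_bialgebra br r (cobracket br r)} =
          {\<mu> *\<^sub>R (e \<otimes> e) + \<gamma> *\<^sub>R (e \<otimes> f) + \<gamma> *\<^sub>R (f \<otimes> e) | \<mu> \<gamma>. True} \<union>
          {\<mu> *\<^sub>R (e \<otimes> e) - \<mu> *\<^sub>R (e \<otimes> f) - \<mu> *\<^sub>R (f \<otimes> e) + \<mu> *\<^sub>R (f \<otimes> f) | \<mu>. True} \<and>
        (\<forall>\<mu> \<gamma> r. r = \<mu> *\<^sub>R (e \<otimes> e) + \<gamma> *\<^sub>R (e \<otimes> f) + \<gamma> *\<^sub>R (f \<otimes> e) \<longrightarrow>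
          cobracket br r e = 0 \<and>
          cobracket br r f = (\<mu> + \<gamma>) *\<^sub>R (e \<otimes> e) + \<gamma> *\<^sub>R (e \<otimes> f)) \<and>
        (\<forall>\<mu> r. r = \<mu> *\<^sub>R (e \<otimes> e) - \<mu> *\<^sub>R (e \<otimes> f) - \<mu> *\<^sub>R (f \<otimes> e) + \<mu> *\<^sub>R (f \<otimes> f) \<longrightarrow>
          cobracket br r e = \<mu> *\<^sub>R (e \<otimes> f - f \<otimes> e) \<and>
          cobracket br r f = \<mu> *\<^sub>R (e \<otimes> f - f \<otimes> e))"
      unfolding coords_family_1 coords_family_2
      by (simp add: leibniz cobracket_coords scaleR_diff_right)
  qed
qed

end
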